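(* Let $G$ be a finite, simple, connected graph with at least one edge, on vertex set $\{1,\dots,N\}$, let $\nabla_G=\{\pm(\mathbf e_i-\mathbf e_j)\mid \{i,j\}\in\mathcal E(G)\}\subset\mathbb R^N$, and let $F$ be a nonempty proper face of $\nabla_G$. Then: (i) $F$ is affinely independent if and only if $G_F$ is a forest; (ii) $F$ is a circuit if and only if $G_F$ is a chordless cycle; (iii) $\dim(F)=|\mathcal V(G_F)|-k-1$, where $k$ is the number of connected components of $G_F$; (iv) the corank of $F$ equals the cyclomatic number of $G_F$.
   Context: $\mathbf e_1,\dots,\mathbf e_N$ is the standard basis of $\mathbb R^N$. A subset $F\subseteq\nabla_G$ is a face of $\nabla_G$ if $F=\nabla_G\cap P'$ for a face $P'$ of the polytope $\operatorname{conv}(\nabla_G)$. $G_F$ is the undirected graph whose edges are the $\{i,j\}$ with $\mathbf e_i-\mathbf e_j\in F$ or $\mathbf e_j-\mathbf e_i\in F$, and whose vertices are the endpoints of these edges. For a finite point set $X$: $\dim(X)=\dim\operatorname{conv}(X)$; $X$ is affinely dependent if there are reals $\lambda_x$, not all zero, with $\sum\lambda_x=0$ and $\sum\lambda_x x=\mathbf 0$, and affinely independent otherwise; $X$ is a circuit if it is affinely dependent but every proper subset is affinely independent; the corank of $X$ is $|X|-\dim(X)-1$. The cyclomatic number of a graph is $|\mathcal E|-|\mathcal V|+(\text{number of connected components})$, the minimum number of edges whose deletion makes it acyclic. *)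

theory Defs
  imports "HOL-Analysis.Analysis"
begin

text \<open>An undirected graph is a pair of a vertex set and a set of edges, each edge being the set
  of its endpoints.\<close>

type_synonym 'a graph = "'a set \<times> 'a set set"

definition verts :: "'a graph \<Rightarrow> 'a set" where
  "verts G = fst G"

definition edges :: "'a graph \<Rightarrow> 'a set set" where
  "edges G = snd G"

definition finite_simple_graph :: "'a graph \<Rightarrow> bool" where
  "finite_simple_graph G \<longleftrightarrow> finite (verts G) \<and> (\<forall>e\<in>edges G. e \<subseteq> verts G \<and> card e = 2)"

definition reachable :: "'a graph \<Rightarrow> ('a \<times> 'a) set" where
  "reachable G = {(u, v). u \<in> verts G \<and> v \<in> verts G \<and> (u, v) \<in> {(a, b). {a, b} \<in> edges G}\<^sup>*}"

definition connected_graph :: "'a graph \<Rightarrow> bool" where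
  "connected_graph G \<longleftrightarrow> verts G \<noteq> {} \<and> (\<forall>u\<in>verts G. \<forall>v\<in>verts G. (u, v) \<in> reachable G)"

definition components_of_graph :: "'a graph \<Rightarrow> 'a set set" where
  "components_of_graph G = verts G // reachable G"

definition cyclomatic_number :: "'a graph \<Rightarrow> int" where
  "cyclomatic_number G =
     int (card (edges G)) - int (card (verts G)) + int (card (components_of_graph G))"

text \<open>A cycle is given by the list of its distinct vertices in cyclic order.\<close>

definition cycle_edges :: "'a list \<Rightarrow> 'a set set" where
  "cycle_edges vs = {{vs ! i, vs ! (Suc i mod length vs)} | i. i < length vs}"

definition cycle_in :: "'a graph \<Rightarrow> 'a list \<Rightarrow> bool" where
  "cycle_in G vs \<longleftrightarrow>
     3 \<le> length vs \<and> distinct vs \<and> set vs \<subseteq> verts G \<and> cycle_edges vs \<subseteq> edges G"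

definition forest :: "'a graph \<Rightarrow> bool" where
  "forest G \<longleftrightarrow> (\<nexists>vs. cycle_in G vs)"

definition chord :: "'a graph \<Rightarrow> 'a list \<Rightarrow> 'a set \<Rightarrow> bool" where
  "chord G vs e \<longleftrightarrow> e \<in> edges G \<and> e \<subseteq> set vs \<and> e \<notin> cycle_edges vs"

text \<open>Chords are taken in the graph itself, not in an ambient graph of which it is a subgraph:
  in \<open>K\<^sub>4\<close>, the face \<open>{e\<^sub>1 - e\<^sub>3, e\<^sub>1 - e\<^sub>4, e\<^sub>2 - e\<^sub>3, e\<^sub>2 - e\<^sub>4}\<close> is a circuit and its graph is a
  4-cycle which is not an induced subgraph of \<open>K\<^sub>4\<close>.\<close>

definition is_chordless_cycle :: "'a graph \<Rightarrow> bool" where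
  "is_chordless_cycle G \<longleftrightarrow> (\<exists>vs. cycle_in G vs \<and> set vs = verts G \<and> (\<nexists>e. chord G vs e))"

definition nabla :: "'n::finite graph \<Rightarrow> (real ^ 'n) set" where
  "nabla G = {x. \<exists>i j. {i, j} \<in> edges G \<and>
                   (x = axis i 1 - axis j 1 \<or> x = - (axis i 1 - axis j 1))}"

definition face_of_points :: "'a::real_vector set \<Rightarrow> 'a set \<Rightarrow> bool" where
  "face_of_points F X \<longleftrightarrow> (\<exists>P. P face_of (convex hull X) \<and> F = X \<inter> P)"

definition face_edges :: "(real ^ 'n::finite) set \<Rightarrow> 'n set set" where
  "face_edges F = {{i, j} | i j. axis i 1 - axis j 1 \<in> F \<or> axis j 1 - axis i 1 \<in> F}"

definition face_graph :: "(real ^ 'n::finite) set \<Rightarrow> 'n graph" where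
  "face_graph F = (\<Union> (face_edges F), face_edges F)"

text \<open>For affine dependence we use the library's \<^const>\<open>affine_dependent\<close>;
  \<open>affine_dependent_explicit_finite\<close> is the formulation with coefficients.\<close>

definition circuit :: "'a::real_vector set \<Rightarrow> bool" where
  "circuit X \<longleftrightarrow> affine_dependent X \<and> (\<forall>Y. Y \<subset> X \<longrightarrow> \<not> affine_dependent Y)"

definition dim_points :: "'a::euclidean_space set \<Rightarrow> int" where
  "dim_points X = aff_dim (convex hull X)"

definition corank :: "'a::euclidean_space set \<Rightarrow> int" where
  "corank X = int (card X) - dim_points X - 1"

end

theory Submission
  imports Defs
begin

text \<open>Since the root polytope is centrally symmetric, a proper face lies on a hyperplane
  \<open>a \<bullet> x = b\<close> with \<open>b \<noteq> 0\<close>. Hence on \<open>F\<close> affine and linear dependence coincide, the affine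
  dimension is one less than the dimension of the span, and \<open>F\<close> contains at most one of the two
  orientations of each edge. A root \<open>e\<^sub>i - e\<^sub>j\<close> lies in the span of \<open>F\<close> iff \<open>i\<close> and \<open>j\<close> are
  connected in \<open>G\<^sub>F\<close>, as the sum of the coordinates over a component vanishes on \<open>F\<close>. So a
  linear dependence amounts to an edge whose ends remain connected after its deletion,
  that is, to a cycle.\<close>

text \<open>The relation whose closure occurs in \<open>reachable\<close>, taken on an edge set
  alone: deleting an edge then leaves the question of vertices aside.\<close>

definition adjacency :: "'a set set \<Rightarrow> ('a \<times> 'a) set" where
  "adjacency E = {(a, b). {a, b} \<in> E}"

lemma sym_adjacency: "sym (adjacency E)"
  by (auto simp: adjacency_def sym_def insert_commute)

lemma adjacency_rtrancl_sym: "(u, v) \<in> (adjacency E)\<^sup>* \<Longrightarrow> (v, u) \<in> (adjacency E)\<^sup>*"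
  by (meson sym_adjacency sym_rtrancl symD)

lemma adjacency_rtrancl_mono: "E \<subseteq> E' \<Longrightarrow> (adjacency E)\<^sup>* \<subseteq> (adjacency E')\<^sup>*"
  by (rule rtrancl_mono) (auto simp: adjacency_def)

section \<open>Cycles\<close>

text \<open>Equal edges at different positions would make each position the cyclic successor of the
  other, so that two steps go once round. That needs length at most 2.\<close>

lemma cycle_edge_index:
  assumes "3 \<le> length vs" "distinct vs" "i < length vs" "j < length vs"
    and eq: "{vs ! i, vs ! (Suc i mod length vs)} = {vs ! j, vs ! (Suc j mod length vs)}"
  shows "i = j"
proof (rule ccontr)
  let ?n = "length vs"
  assume "i \<noteq> j"
  have succ: "Suc k mod ?n = (if Suc k = ?n then 0 else Suc k)" if "k < ?n" for k
    using that by (simp add: mod_Suc)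
  have "0 < ?n" using assms(3) by linarith
  then have lt: "Suc i mod ?n < ?n" "Suc j mod ?n < ?n"
    by (rule mod_less_divisor)+
  have "vs ! i \<noteq> vs ! j"
    using \<open>i \<noteq> j\<close> assms(2-4) by (simp add: nth_eq_iff_index_eq)
  then have "vs ! i = vs ! (Suc j mod ?n)" "vs ! j = vs ! (Suc i mod ?n)"
    using eq by (auto simp only: doubleton_eq_iff)
  then have "i = Suc j mod ?n" "j = Suc i mod ?n"
    using assms(2-4) lt by (simp_all only: nth_eq_iff_index_eq)
  then have "i = 0 \<and> Suc j = ?n \<or> i = Suc j" "j = 0 \<and> Suc i = ?n \<or> j = Suc i"
    using succ[OF assms(3)] succ[OF assms(4)] by metis+
  then show False
    using assms(1) by linarith
qed

lemma card_cycle_edges: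
  assumes "3 \<le> length vs" "distinct vs"
  shows "card (cycle_edges vs) = length vs"
proof -
  have "cycle_edges vs = (\<lambda>i. {vs ! i, vs ! (Suc i mod length vs)}) ` {..<length vs}"
    by (auto simp: cycle_edges_def)
  moreover have "inj_on (\<lambda>i. {vs ! i, vs ! (Suc i mod length vs)}) {..<length vs}"
    using cycle_edge_index[OF assms] by (auto simp: inj_on_def)
  ultimately show ?thesis
    by (simp add: card_image)
qed

text \<open>Walking forward from the second end of \<open>e\<close>, the first \<open>k\<close>
  steps use the edges at positions \<open>i + 1\<close> to \<open>i + k\<close> modulo the length.
  Position \<open>i\<close> would recur only at a full turn, hence the bound on
  \<open>k\<close>.\<close>

lemma cycle_path_avoiding_edge:
  assumes "3 \<le> length vs" "distinct vs" "i < length vs" "k < length vs"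
  defines "e \<equiv> {vs ! i, vs ! (Suc i mod length vs)}"
  shows "(vs ! (Suc i mod length vs), vs ! ((Suc i + k) mod length vs))
    \<in> (adjacency (cycle_edges vs - {e}))\<^sup>*"
  using \<open>k < length vs\<close>
proof (induction k)
  case 0
  then show ?case by simp
next
  case (Suc k)
  let ?n = "length vs"
  let ?j = "(Suc i + k) mod ?n"
  have j: "?j < ?n" using Suc.prems by (auto intro: mod_less_divisor)
  have next_j: "Suc ?j mod ?n = (Suc i + Suc k) mod ?n"
    by (simp add: mod_Suc_eq)
  have "?j \<noteq> i"
  proof
    assume "?j = i"
    then have "(i + Suc k) mod ?n = (i + 0) mod ?n" using assms(3) by simp
    then have "?n dvd Suc k"
      by (metis add_diff_cancel_left' diff_zero le_add1 mod_eq_dvd_iff_nat add_0_right)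
    with Suc.prems show False by (simp add: nat_dvd_not_less)
  qed
  then have "{vs ! ?j, vs ! (Suc ?j mod ?n)} \<noteq> e"
    using cycle_edge_index[OF assms(1,2) j assms(3)] by (auto simp: e_def)
  moreover have "{vs ! ?j, vs ! (Suc ?j mod ?n)} \<in> cycle_edges vs"
    using j by (auto simp: cycle_edges_def)
  ultimately have "(vs ! ?j, vs ! ((Suc i + Suc k) mod ?n)) \<in> adjacency (cycle_edges vs - {e})"
    by (simp only: adjacency_def next_j) simp
  moreover have "(vs ! (Suc i mod ?n), vs ! ?j) \<in> (adjacency (cycle_edges vs - {e}))\<^sup>*"
    using Suc by simp
  ultimately show ?case by (rule rtrancl_into_rtrancl[rotated])
qed

lemma cycle_edge_ends_connected:
  assumes "3 \<le> length vs" "distinct vs" "{u, v} \<in> cycle_edges vs"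
  shows "(u, v) \<in> (adjacency (cycle_edges vs - {{u, v}}))\<^sup>*"
proof -
  let ?n = "length vs"
  obtain i where i: "i < ?n" and e: "{u, v} = {vs ! i, vs ! (Suc i mod ?n)}"
    using assms(3) by (auto simp: cycle_edges_def)
  \<comment> \<open>The longest walk that still avoids the edge ends at its first end.\<close>
  have "(Suc i + (?n - 1)) mod ?n = i"
    using i by (metis Suc_pred' add_Suc_shift gr_implies_not0 mod_add_self2 mod_less neq0_conv)
  then have "(vs ! (Suc i mod ?n), vs ! i) \<in> (adjacency (cycle_edges vs - {{u, v}}))\<^sup>*"
    using cycle_path_avoiding_edge[OF assms(1,2) i, of "?n - 1"] i unfolding e by auto
  with e show ?thesis
    by (auto simp: doubleton_eq_iff dest: adjacency_rtrancl_sym)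
qed

lemma cycle_connected:
  assumes "3 \<le> length vs" "distinct vs" "u \<in> set vs" "v \<in> set vs"
  shows "(u, v) \<in> (adjacency (cycle_edges vs))\<^sup>*"
proof -
  let ?n = "length vs"
  have "(vs ! (Suc 0 mod ?n), w) \<in> (adjacency (cycle_edges vs))\<^sup>*" if w: "w \<in> set vs" for w
  proof -
    obtain i where i: "i < ?n" "w = vs ! i" using w by (auto simp: in_set_conv_nth)
    \<comment> \<open>The walk avoiding the edge at position 0 starts at position 1, so position 0
      is the last one reached, after length minus one steps.\<close>
    define k where "k = (if i = 0 then ?n - 1 else i - 1)"
    have k: "k < ?n" "(Suc 0 + k) mod ?n = i" using i assms(1) by (auto simp: k_def)
    show ?thesis
      using cycle_path_avoiding_edge[OF assms(1,2) _ k(1), of 0] k i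
        adjacency_rtrancl_mono[of "cycle_edges vs - _" "cycle_edges vs"]
      by fastforce
  qed
  then show ?thesis
    using assms adjacency_rtrancl_sym rtrancl_trans by meson
qed

text \<open>A walk is built from its end backwards. If the new first vertex already lies on the
  path, the loop is cut off by restarting at that occurrence.\<close>

lemma rtrancl_imp_simple_path:
  assumes "(u, v) \<in> r\<^sup>*"
  shows "\<exists>xs. xs \<noteq> [] \<and> distinct xs \<and> hd xs = u \<and> last xs = v
    \<and> successively (\<lambda>a b. (a, b) \<in> r) xs"
  using assms
proof (induction rule: converse_rtrancl_induct)
  case base
  show ?case by (rule exI[of _ "[v]"]) simp
next
  case (step a c)
  then obtain xs where xs: "xs \<noteq> []" "distinct xs" "hd xs = c" "last xs = v"
    "successively (\<lambda>a b. (a, b) \<in> r) xs"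
    by blast
  show ?case
  proof (cases "a \<in> set xs")
    case True
    then obtain ys zs where "xs = ys @ a # zs" by (meson split_list)
    with xs show ?thesis
      by (intro exI[of _ "a # zs"]) (auto simp: successively_append_iff)
  next
    case False
    with xs step.hyps show ?thesis
      by (intro exI[of _ "a # xs"]) (auto simp: successively_Cons)
  qed
qed

text \<open>The deleted edge closes a simple path between its ends to a cycle; it appears as the
  wrap-around edge of the list.\<close>

lemma connected_ends_imp_cycle:
  assumes "u \<noteq> v" "{u, v} \<in> E" "(u, v) \<in> (adjacency (E - {{u, v}}))\<^sup>*"
  shows "\<exists>vs. cycle_in (\<Union> E, E) vs"
proof -
  obtain xs where xs: "xs \<noteq> []" "distinct xs" "hd xs = u" "last xs = v"
    and path: "successively (\<lambda>a b. (a, b) \<in> adjacency (E - {{u, v}})) xs"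
    using rtrancl_imp_simple_path[OF assms(3)] by blast
  have step: "{xs ! i, xs ! Suc i} \<in> E - {{u, v}}" if "Suc i < length xs" for i
    using path that by (auto simp: successively_conv_nth adjacency_def)
  \<comment> \<open>One vertex would mean \<open>u = v\<close>; two would make the path the deleted
    edge itself.\<close>
  have len: "3 \<le> length xs"
  proof (rule ccontr)
    assume "\<not> 3 \<le> length xs"
    then have "length xs = 1 \<or> length xs = 2"
      using xs(1) by (cases "length xs") auto
    then show False
    proof
      assume "length xs = 1"
      then show False using xs assms(1) by (auto simp: length_Suc_conv)
    next
      assume "length xs = 2"
      then show False using xs step[of 0] by (auto simp: length_Suc_conv numeral_2_eq_2)
    qed
  qed
  have edges: "cycle_edges xs \<subseteq> E"
  proof
    fix e assume "e \<in> cycle_edges xs"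
    then obtain i where i: "i < length xs" "e = {xs ! i, xs ! (Suc i mod length xs)}"
      by (auto simp: cycle_edges_def)
    show "e \<in> E"
    proof (cases "Suc i < length xs")
      case True
      with i step show ?thesis by auto
    next
      case False
      with i have "length xs = Suc i" by simp
      with i have "e = {last xs, hd xs}"
        using xs(1) by (simp add: last_conv_nth hd_conv_nth)
      with xs assms(2) show ?thesis by (simp add: insert_commute)
    qed
  qed
  have "set xs \<subseteq> \<Union> E"
  proof
    fix w assume "w \<in> set xs"
    then obtain i where "i < length xs" "w = xs ! i" by (auto simp: in_set_conv_nth)
    then have "\<exists>e\<in>cycle_edges xs. w \<in> e" by (auto simp: cycle_edges_def)
    with edges show "w \<in> \<Union> E" by blast
  qed
  with len xs edges show ?thesis
    by (auto simp: cycle_in_def verts_def edges_def)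
qed

section \<open>Roots on a hyperplane avoiding the origin\<close>

text \<open>What is retained of a proper face. Unlike being a face, it passes to all subsets, in
  particular to \<open>F - {x}\<close>. As \<open>b\<close> is nonzero, the zero vector (the case
  \<open>i = j\<close>) is excluded.\<close>

definition roots_off_origin :: "(real ^ 'n::finite) set \<Rightarrow> bool" where
  "roots_off_origin F \<longleftrightarrow> (\<exists>a b. b \<noteq> 0 \<and> (\<forall>x\<in>F. a \<bullet> x = b \<and> (\<exists>i j. x = axis i 1 - axis j 1)))"

lemma roots_off_origin_subset: "roots_off_origin F \<Longrightarrow> F' \<subseteq> F \<Longrightarrow> roots_off_origin F'"
  unfolding roots_off_origin_def by blast

lemma roots_off_origin_no_opposite:
  assumes "roots_off_origin F" "x \<in> F"
  shows "- x \<notin> F"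
proof
  assume "- x \<in> F"
  with assms obtain a b where "b \<noteq> 0" "a \<bullet> x = b" "a \<bullet> (- x) = b"
    unfolding roots_off_origin_def by blast
  then show False by simp
qed

lemma roots_off_origin_cases:
  assumes "roots_off_origin F" "x \<in> F"
  obtains i j where "i \<noteq> j" "x = axis i 1 - axis j 1"
  using assms unfolding roots_off_origin_def by force

lemma finite_roots_off_origin:
  fixes F :: "(real ^ 'n::finite) set"
  assumes "roots_off_origin F"
  shows "finite F"
proof (rule finite_subset)
  show "F \<subseteq> range (\<lambda>(i, j). axis i 1 - axis j 1 :: real ^ 'n)"
    using assms unfolding roots_off_origin_def by force
qed simp

text \<open>Sends a root to its edge, forgetting the orientation, so that \<open>face_edges\<close>
  becomes an image.\<close>

definition vec_support :: "real ^ 'n::finite \<Rightarrow> 'n set" where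
  "vec_support x = {k. x $ k \<noteq> 0}"

lemma vec_support_root [simp]:
  "i \<noteq> j \<Longrightarrow> vec_support (axis i 1 - axis j 1 :: real ^ 'n::finite) = {i, j}"
  by (auto simp: vec_support_def axis_def)

lemma face_edges_eq_support:
  assumes "roots_off_origin F"
  shows "face_edges F = vec_support ` F"
proof
  \<comment> \<open>The zero vector is its own opposite. Hence \<open>face_edges\<close> contains no
    singletons.\<close>
  have nz: "axis i 1 - axis i 1 \<notin> F" for i
    using roots_off_origin_no_opposite[OF assms] by force
  show "face_edges F \<subseteq> vec_support ` F"
  proof
    fix e assume "e \<in> face_edges F"
    then obtain i j where e: "e = {i, j}" "axis i 1 - axis j 1 \<in> F \<or> axis j 1 - axis i 1 \<in> F"
      by (auto simp: face_edges_def)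
    then have "i \<noteq> j" using nz by auto
    then have "e = vec_support (axis i 1 - axis j 1)" "e = vec_support (axis j 1 - axis i 1)"
      using e(1) by auto
    with e(2) show "e \<in> vec_support ` F" by blast
  qed
  show "vec_support ` F \<subseteq> face_edges F"
  proof
    fix e assume "e \<in> vec_support ` F"
    then obtain x where x: "x \<in> F" "e = vec_support x" by auto
    then obtain i j where ij: "i \<noteq> j" "x = axis i 1 - axis j 1"
      by (meson roots_off_origin_cases[OF assms])
    with x have "e = {i, j}" by simp
    with x ij show "e \<in> face_edges F" unfolding face_edges_def by blast
  qed
qed

text \<open>Roots with the same support are equal or opposite, and opposite pairs are excluded. So
  points and edges correspond one to one, under counting and under deletion.\<close>

lemma inj_on_vec_support:
  assumes "roots_off_origin F"
  shows "inj_on vec_support F"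
proof (rule inj_onI)
  fix x y assume xy: "x \<in> F" "y \<in> F" "vec_support x = vec_support y"
  obtain i j where ij: "i \<noteq> j" "x = axis i 1 - axis j 1"
    using roots_off_origin_cases[OF assms xy(1)] .
  obtain k l where kl: "k \<noteq> l" "y = axis k 1 - axis l 1"
    using roots_off_origin_cases[OF assms xy(2)] .
  have "{i, j} = {k, l}" using xy(3) ij kl by simp
  then have "x = y \<or> y = - x" using ij kl by (auto simp: doubleton_eq_iff)
  then show "x = y" using roots_off_origin_no_opposite[OF assms xy(1)] xy(2) by auto
qed

lemma card_face_edges: "roots_off_origin F \<Longrightarrow> card (face_edges F) = card F"
  by (simp add: face_edges_eq_support inj_on_vec_support card_image)

lemma face_edges_remove:
  assumes "roots_off_origin F" "x \<in> F"
  shows "face_edges (F - {x}) = face_edges F - {vec_support x}"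
proof -
  have "roots_off_origin (F - {x})" using assms roots_off_origin_subset by blast
  then show ?thesis
    using assms inj_on_vec_support[OF assms(1)]
    by (simp add: face_edges_eq_support inj_on_image_set_diff[of vec_support F F "{x}"])
qed

text \<open>The affine hull stays in the hyperplane and misses 0, so adding 0 raises the affine
  dimension by exactly one, to that of the span.\<close>

lemma aff_dim_roots_off_origin:
  assumes "roots_off_origin F"
  shows "aff_dim F = int (dim F) - 1"
proof -
  obtain a b where ab: "b \<noteq> 0" "F \<subseteq> {x. a \<bullet> x = b}"
    using assms unfolding roots_off_origin_def by blast
  then have "affine hull F \<subseteq> {x. a \<bullet> x = b}"
    by (simp add: affine_hyperplane hull_minimal)
  with ab(1) have "0 \<notin> affine hull F" by auto
  then have "aff_dim (insert 0 F) = aff_dim F + 1" by (simp add: aff_dim_insert)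
  moreover have "aff_dim (insert 0 F) = int (dim (insert 0 F))"
    by (rule aff_dim_zero) (simp add: hull_inc)
  ultimately show ?thesis by (metis dim_span span_insert_0 add_diff_cancel_right')
qed

lemma affine_dependent_iff_dependent_off_origin:
  assumes "roots_off_origin F"
  shows "affine_dependent F \<longleftrightarrow> dependent F"
proof -
  have fin: "finite F" by (rule finite_roots_off_origin[OF assms])
  \<comment> \<open>Both kinds of independence say that the dimension is as large as the cardinality
    permits; no coefficients are compared.\<close>
  have "\<not> affine_dependent F \<longleftrightarrow> dim F = card F"
    using fin by (auto simp: affine_independent_iff_card aff_dim_roots_off_origin[OF assms])
  also have "\<dots> \<longleftrightarrow> independent F"
    using fin dim_eq_card_independent[of F] card_le_dim_spanning[of F F]
    by (auto simp: span_superset)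
  finally show ?thesis by blast
qed

section \<open>The span of the roots\<close>

lemma root_in_span_iff_connected:
  fixes F :: "(real ^ 'n::finite) set"
  assumes "roots_off_origin F"
  shows "axis i 1 - axis j 1 \<in> span F \<longleftrightarrow> (i, j) \<in> (adjacency (face_edges F))\<^sup>*"
proof
  \<comment> \<open>\<open>C\<close> is the component of \<open>i\<close>, and \<open>f\<close> sums
    the coordinates over it. Edges do not leave \<open>C\<close>, so \<open>f\<close> vanishes on
    \<open>F\<close>, whereas it is 1 on the root if \<open>j\<close> lies outside
    \<open>C\<close>.\<close>
  define C where "C = {v. (i, v) \<in> (adjacency (face_edges F))\<^sup>*}"
  define f :: "real ^ 'n \<Rightarrow> real" where "f x = (\<Sum>v\<in>C. x $ v)" for x
  have f_root: "f (axis k 1 - axis l 1) = of_bool (k \<in> C) - of_bool (l \<in> C)" for k l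
    by (auto simp: f_def sum_subtractf axis_def)
  assume "axis i 1 - axis j 1 \<in> span F"
  moreover have "linear f"
    by (rule linearI) (simp_all add: f_def sum.distrib sum_distrib_left)
  moreover have "f x = 0" if x: "x \<in> F" for x
  proof -
    obtain k l where kl: "k \<noteq> l" "x = axis k 1 - axis l 1"
      using roots_off_origin_cases[OF assms x] .
    with x have "(k, l) \<in> adjacency (face_edges F)" "(l, k) \<in> adjacency (face_edges F)"
      by (auto simp: adjacency_def face_edges_eq_support[OF assms] image_iff insert_commute
          intro!: bexI[of _ x])
    then have "k \<in> C \<longleftrightarrow> l \<in> C"
      unfolding C_def by (auto intro: rtrancl_into_rtrancl)
    with kl f_root show ?thesis by simp
  qed
  ultimately have "f (axis i 1 - axis j 1) = 0"
    using linear_eq_0_on_span by blast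
  moreover have "i \<in> C" by (simp add: C_def)
  ultimately have "j \<in> C" by (simp add: f_root split: if_splits)
  then show "(i, j) \<in> (adjacency (face_edges F))\<^sup>*" by (simp add: C_def)
next
  assume "(i, j) \<in> (adjacency (face_edges F))\<^sup>*"
  then show "axis i 1 - axis j 1 \<in> span F"
  proof (induction rule: rtrancl_induct)
    case base
    show ?case by (simp add: span_zero)
  next
    \<comment> \<open>The roots along the path telescope; their orientations do not matter in a
      span.\<close>
    case (step k l)
    then have "axis k 1 - axis l 1 \<in> F \<or> axis l 1 - axis k 1 \<in> F"
      by (auto simp: adjacency_def face_edges_def doubleton_eq_iff)
    then have "axis k 1 - axis l 1 \<in> span F"
      using span_neg[of "axis l 1 - axis k 1" F] by (auto intro: span_base)
    from span_add[OF step.IH this] show ?case by simp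
  qed
qed

section \<open>Connected components and the dimension formula\<close>

lemma equiv_reachable: "equiv (verts G) (reachable G)"
proof (rule equivI)
  have "(u, v) \<in> (adjacency (edges G))\<^sup>* \<Longrightarrow> (v, u) \<in> (adjacency (edges G))\<^sup>*" for u v
    by (rule adjacency_rtrancl_sym)
  then show "sym (reachable G)"
    by (auto simp: reachable_def sym_def adjacency_def)
qed (auto simp: reachable_def refl_on_def trans_def)

lemma reachable_face_graph:
  "(u, v) \<in> reachable (face_graph F) \<longleftrightarrow>
    u \<in> verts (face_graph F) \<and> v \<in> verts (face_graph F) \<and> (u, v) \<in> (adjacency (face_edges F))\<^sup>*"
  by (simp add: reachable_def adjacency_def face_graph_def edges_def)

text \<open>In each component, a star centred at a representative has the same span as the roots of
  that component, and its differences are independent. The additive form avoids truncated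
  subtraction.\<close>

lemma card_quotient_add_dim:
  fixes F :: "(real ^ 'n::finite) set"
  assumes F: "roots_off_origin F"
  shows "card (components_of_graph (face_graph F)) + dim F = card (verts (face_graph F))"
proof -
  define V where "V = verts (face_graph F)"
  define R where "R = reachable (face_graph F)"
  have R: "equiv V R" unfolding V_def R_def by (rule equiv_reachable)
  \<comment> \<open>The choice depends only on the class of \<open>v\<close>, so \<open>r\<close> is
    constant on components and idempotent on \<open>V\<close>.\<close>
  define r where "r v = (SOME w. w \<in> R `` {v})" for v
  have r: "(v, r v) \<in> R" if "v \<in> V" for v
    using someI[of "\<lambda>w. w \<in> R `` {v}" v] equiv_class_self[OF R that] by (simp add: r_def)
  have rV: "r v \<in> V" if "v \<in> V" for v
    using r[OF that] by (simp add: V_def R_def reachable_face_graph)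
  have r_eq: "r v = r w" if "(v, w) \<in> R" for v w
    using equiv_class_eq[OF R that] by (simp add: r_def)
  have rr: "r (r v) = r v" if "v \<in> V" for v
    using r_eq[OF r[OF that]] by simp
  \<comment> \<open>Basis of the span: the differences of each vertex to the representative of its component.\<close>
  define g :: "'n \<Rightarrow> real ^ 'n" where "g v = axis v 1 - axis (r v) 1" for v
  define W where "W = V - r ` V"
  \<comment> \<open>On the coordinates in \<open>W\<close> the vectors \<open>g v\<close> form an
    identity matrix, since representatives lie outside \<open>W\<close>. This gives both injectivity
    and independence.\<close>
  have g_coord: "g v $ w = of_bool (v = w)" if "v \<in> W" "w \<in> W" for v w
  proof -
    have "r v \<noteq> w" using that by (auto simp: W_def)
    then show ?thesis by (simp add: g_def axis_def)
  qed
  have inj: "inj_on g W"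
    by (rule inj_onI) (metis g_coord of_bool_eq_iff)
  have indep: "independent (g ` W)"
  proof
    assume "dependent (g ` W)"
    then obtain v where v: "v \<in> W" "g v \<in> span (g ` W - {g v})"
      by (auto simp: dependent_def)
    have "g w $ v = 0" if "g w \<noteq> g v" "w \<in> W" for w
      using g_coord[OF that(2) v(1)] that(1) by auto
    then have "y $ v = 0" if "y \<in> g ` W - {g v}" for y
      using that by blast
    moreover have "linear (\<lambda>y :: real ^ 'n. y $ v)"
      by (rule linearI) simp_all
    ultimately have "g v $ v = 0"
      using linear_eq_0_on_span[of "\<lambda>y. y $ v"] v(2) by blast
    with g_coord[OF v(1) v(1)] show False by simp
  qed
  have g_span: "g v \<in> span (g ` W)" if "v \<in> V" for v
  proof (cases "v \<in> W")
    case True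
    then show ?thesis by (simp add: span_base)
  next
    case False
    with that rr have "g v = 0" by (auto simp: W_def g_def)
    then show ?thesis by (simp add: span_zero)
  qed
  have "g ` W \<subseteq> span F"
    using r by (auto simp: g_def W_def R_def reachable_face_graph root_in_span_iff_connected[OF F])
  moreover have "F \<subseteq> span (g ` W)"
  proof
    fix x assume x: "x \<in> F"
    obtain i j where ij: "i \<noteq> j" "x = axis i 1 - axis j 1"
      using roots_off_origin_cases[OF F x] .
    then have e: "{i, j} \<in> face_edges F"
      using x by (auto simp: face_edges_def)
    then have "i \<in> V" "j \<in> V" by (auto simp: V_def verts_def face_graph_def)
    moreover from e have "(i, j) \<in> (adjacency (face_edges F))\<^sup>*"
      by (auto simp: adjacency_def)
    ultimately have "(i, j) \<in> R" by (simp add: R_def V_def reachable_face_graph)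
    \<comment> \<open>Both ends have the same representative, which cancels.\<close>
    then have "x = g i - g j" using r_eq[of i j] ij by (simp add: g_def)
    with \<open>i \<in> V\<close> \<open>j \<in> V\<close> g_span show "x \<in> span (g ` W)" by (simp add: span_diff)
  qed
  ultimately have "span (g ` W) = span F"
    by (meson span_minimal subspace_span subset_antisym)
  then have "dim F = card (g ` W)"
    using indep by (metis dim_span dim_eq_card_independent)
  also have "\<dots> = card W" using inj by (rule card_image)
  also have "\<dots> = card V - card (r ` V)"
    using rV by (auto simp: W_def intro!: card_Diff_subset)
  finally have dim: "dim F = card V - card (r ` V)" .
  \<comment> \<open>Distinct classes are disjoint, so there are as many representatives as
    components.\<close>
  have "inj_on (\<lambda>C. SOME w. w \<in> C) (V // R)"
  proof (rule inj_onI)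
    fix C D assume CD: "C \<in> V // R" "D \<in> V // R" "(SOME w. w \<in> C) = (SOME w. w \<in> D)"
    then have "(SOME w. w \<in> C) \<in> C" "(SOME w. w \<in> D) \<in> D"
      using in_quotient_imp_non_empty[OF R] unfolding some_in_eq by blast+
    with CD quotient_disj[OF R CD(1,2)] show "C = D" by auto
  qed
  moreover have "r ` V = (\<lambda>C. SOME w. w \<in> C) ` (V // R)"
    by (simp add: r_def quotient_def UNION_singleton_eq_range image_image)
  ultimately have "card (r ` V) = card (V // R)" by (simp add: card_image)
  moreover have "card (r ` V) \<le> card V" using rV by (intro card_mono) auto
  ultimately show ?thesis
    using dim by (simp add: components_of_graph_def V_def R_def)
qed

section \<open>Forests, circuits and chordless cycles\<close>

text \<open>Applying \<open>root_in_span_iff_connected\<close> to \<open>F - {x}\<close> turns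
  linear redundancy of \<open>x\<close> into connectedness of the ends of its edge after
  deletion.\<close>

lemma independent_iff_forest:
  fixes F :: "(real ^ 'n::finite) set"
  assumes F: "roots_off_origin F"
  shows "independent F \<longleftrightarrow> forest (face_graph F)"
proof
  assume indep: "independent F"
  show "forest (face_graph F)"
    unfolding forest_def
  proof
    assume "\<exists>vs. cycle_in (face_graph F) vs"
    then obtain vs where vs: "3 \<le> length vs" "distinct vs" "cycle_edges vs \<subseteq> face_edges F"
      by (auto simp: cycle_in_def face_graph_def edges_def)
    have "0 < length vs" using vs(1) by linarith
    then obtain e where e: "e \<in> cycle_edges vs" by (auto simp: cycle_edges_def)
    then obtain x where x: "x \<in> F" "e = vec_support x"
      using vs(3) face_edges_eq_support[OF F] by auto
    obtain i j where ij: "i \<noteq> j" "x = axis i 1 - axis j 1"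
      using roots_off_origin_cases[OF F x(1)] .
    then have e_ij: "e = {i, j}" using x by simp
    have "(i, j) \<in> (adjacency (cycle_edges vs - {e}))\<^sup>*"
      using cycle_edge_ends_connected[OF vs(1,2)] e e_ij by blast
    then have "(i, j) \<in> (adjacency (face_edges (F - {x})))\<^sup>*"
      using adjacency_rtrancl_mono[of "cycle_edges vs - {e}" "face_edges F - {e}"] vs(3)
      by (auto simp: face_edges_remove[OF F x(1)] x(2))
    then have "x \<in> span (F - {x})"
      using root_in_span_iff_connected[OF roots_off_origin_subset[OF F, of "F - {x}"]] ij by auto
    with indep x(1) show False by (auto simp: dependent_def)
  qed
next
  assume forest: "forest (face_graph F)"
  show "independent F"
  proof
    assume "dependent F"
    then obtain x where x: "x \<in> F" "x \<in> span (F - {x})" by (auto simp: dependent_def)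
    obtain i j where ij: "i \<noteq> j" "x = axis i 1 - axis j 1"
      using roots_off_origin_cases[OF F x(1)] .
    have "(i, j) \<in> (adjacency (face_edges (F - {x})))\<^sup>*"
      using root_in_span_iff_connected[OF roots_off_origin_subset[OF F, of "F - {x}"], of i j] ij x
      by auto
    then have "(i, j) \<in> (adjacency (face_edges F - {{i, j}}))\<^sup>*"
      unfolding face_edges_remove[OF F x(1)] using ij by simp
    moreover have "{i, j} \<in> face_edges F" using x ij by (auto simp: face_edges_def)
    ultimately show False
      using connected_ends_imp_cycle[OF ij(1)] forest
      by (auto simp: forest_def face_graph_def)
  qed
qed

text \<open>Dependence yields a cycle. The roots \<open>Y\<close> on its edges are already
  dependent, so minimality forces \<open>Y = F\<close> and no further edges remain.\<close>

lemma circuit_imp_chordless_cycle: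
  assumes F: "roots_off_origin F" and circ: "circuit F"
  shows "is_chordless_cycle (face_graph F)"
proof -
  have "dependent F"
    using circ by (simp add: circuit_def affine_dependent_iff_dependent_off_origin[OF F])
  then obtain vs where vs: "cycle_in (face_graph F) vs"
    using independent_iff_forest[OF F] by (auto simp: forest_def)
  then have vs': "3 \<le> length vs" "distinct vs" "set vs \<subseteq> \<Union> (face_edges F)"
    "cycle_edges vs \<subseteq> face_edges F"
    by (auto simp: cycle_in_def face_graph_def verts_def edges_def)
  define Y where "Y = {x \<in> F. vec_support x \<in> cycle_edges vs}"
  have "Y \<subseteq> F" by (auto simp: Y_def)
  then have Y: "roots_off_origin Y" by (rule roots_off_origin_subset[OF F])
  have eY: "face_edges Y = cycle_edges vs"
    using vs'(4) unfolding face_edges_eq_support[OF F] face_edges_eq_support[OF Y]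
    by (auto simp: Y_def)
  have sub: "\<Union> (cycle_edges vs) \<subseteq> set vs"
  proof -
    have "0 < length vs" using vs'(1) by linarith
    then have "vs ! (Suc i mod length vs) \<in> set vs" for i
      by (intro nth_mem mod_less_divisor)
    then show ?thesis by (auto simp: cycle_edges_def)
  qed
  have sup: "set vs \<subseteq> \<Union> (cycle_edges vs)"
  proof
    fix w assume "w \<in> set vs"
    then obtain i where "i < length vs" "w = vs ! i" by (auto simp: in_set_conv_nth)
    then show "w \<in> \<Union> (cycle_edges vs)"
      unfolding cycle_edges_def by blast
  qed
  have "cycle_in (face_graph Y) vs"
    using vs'(1,2) sup by (simp add: cycle_in_def face_graph_def verts_def edges_def eY)
  then have "dependent Y"
    using independent_iff_forest[OF Y] by (auto simp: forest_def)
  then have "Y = F"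
    using circ affine_dependent_iff_dependent_off_origin[OF Y] \<open>Y \<subseteq> F\<close>
    unfolding circuit_def by blast
  with eY have "face_edges F = cycle_edges vs" by simp
  moreover from this have "set vs = verts (face_graph F)"
    using sub sup by (simp add: face_graph_def verts_def)
  ultimately show ?thesis
    using vs by (auto simp: is_chordless_cycle_def chord_def face_graph_def edges_def)
qed

text \<open>A cycle of length n has n edges and one component, so the roots have rank n - 1; each of
  them lies in the span of the others.\<close>

lemma chordless_cycle_imp_circuit:
  assumes F: "roots_off_origin F" and chordless: "is_chordless_cycle (face_graph F)"
  shows "circuit F"
proof -
  obtain vs where vs: "3 \<le> length vs" "distinct vs" "set vs = \<Union> (face_edges F)"
    and sub: "cycle_edges vs \<subseteq> face_edges F" and no_chord: "\<nexists>e. chord (face_graph F) vs e"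
    and cyc: "cycle_in (face_graph F) vs"
    using chordless
    by (auto simp: is_chordless_cycle_def cycle_in_def face_graph_def verts_def edges_def)
  \<comment> \<open>The cycle passes through all vertices, so any edge off it would be a
    chord.\<close>
  have edges: "face_edges F = cycle_edges vs"
    using no_chord sub vs(3) by (auto simp: chord_def face_graph_def edges_def)
  have V: "verts (face_graph F) = set vs" by (simp add: vs(3) face_graph_def verts_def)
  have fin: "finite F" by (rule finite_roots_off_origin[OF F])
  have cardF: "card F = length vs"
    using card_cycle_edges[OF vs(1,2)] card_face_edges[OF F] edges by simp
  have "components_of_graph (face_graph F) = {set vs}"
  proof -
    have "reachable (face_graph F) `` {v} = set vs" if "v \<in> set vs" for v
      using cycle_connected[OF vs(1,2) that] that
      by (auto simp: reachable_face_graph V edges)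
    moreover have "set vs \<noteq> {}" using vs(1) by auto
    ultimately show ?thesis by (auto simp: components_of_graph_def V quotient_def)
  qed
  then have dimF: "Suc (dim F) = card F"
    using card_quotient_add_dim[OF F] cardF vs(2) by (simp add: V distinct_card)
  have remove: "independent (F - {x})" if x: "x \<in> F" for x
  proof -
    obtain i j where ij: "i \<noteq> j" "x = axis i 1 - axis j 1"
      using roots_off_origin_cases[OF F x] .
    have "{i, j} \<in> cycle_edges vs" using x ij edges by (auto simp: face_edges_def)
    then have "(i, j) \<in> (adjacency (face_edges (F - {x})))\<^sup>*"
      unfolding face_edges_remove[OF F x] edges
      using cycle_edge_ends_connected[OF vs(1,2), of i j] ij by simp
    then have "x \<in> span (F - {x})"
      using root_in_span_iff_connected[OF roots_off_origin_subset[OF F, of "F - {x}"]] ij by auto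
    then have "F \<subseteq> span (F - {x})"
      by (auto intro: span_base)
    \<comment> \<open>\<open>F - {x}\<close> spans \<open>F\<close> and has exactly
      \<open>dim F\<close> elements, hence is independent.\<close>
    then show ?thesis
      using card_le_dim_spanning[of "F - {x}" F] fin dimF x by auto
  qed
  have "dependent F"
    using cyc independent_iff_forest[OF F] by (auto simp: forest_def)
  moreover have "independent Y" if Y: "Y \<subset> F" for Y
  proof -
    obtain x where "x \<in> F" "Y \<subseteq> F - {x}" using Y by blast
    then show ?thesis using remove independent_mono by blast
  qed
  ultimately show ?thesis
    using F roots_off_origin_subset[OF F]
    by (auto simp: circuit_def affine_dependent_iff_dependent_off_origin psubset_imp_subset)
qed

section \<open>Faces\<close>

text \<open>Faces of a polytope are exposed, which provides the hyperplane. Were \<open>b\<close>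
  zero, the inequality for \<open>x\<close> and for \<open>- x\<close> would put every root on it,
  and \<open>F\<close> would not be proper.\<close>

lemma proper_face_roots_off_origin:
  fixes G :: "'n::finite graph" and F :: "(real ^ 'n) set"
  assumes "face_of_points F (nabla G)" "F \<noteq> nabla G"
  shows "roots_off_origin F"
proof -
  obtain P where P: "P face_of convex hull (nabla G)" "F = nabla G \<inter> P"
    using assms(1) by (auto simp: face_of_points_def)
  have "nabla G \<subseteq> range (\<lambda>(i, j). axis i 1 - axis j 1 :: real ^ 'n)"
    by (auto simp: nabla_def image_iff split_paired_Ex)
  then have "finite (nabla G)" by (rule finite_subset) simp
  then have "polyhedron (convex hull (nabla G))"
    by (simp add: polyhedron_convex_hull)
  with P(1) have "P exposed_face_of convex hull (nabla G)"
    by (simp add: exposed_face_of_polyhedron)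
  then obtain a b where ab: "convex hull (nabla G) \<subseteq> {x. a \<bullet> x \<le> b}"
    "P = convex hull (nabla G) \<inter> {x. a \<bullet> x = b}"
    by (auto simp: exposed_face_of_def)
  have bound: "a \<bullet> x \<le> b" if "x \<in> nabla G" for x
    using ab(1) that by (auto dest: hull_inc[of _ _ convex])
  have F_eq: "F = {x \<in> nabla G. a \<bullet> x = b}"
    using P(2) ab(2) by (auto intro: hull_inc)
  have "b \<noteq> 0"
  proof
    assume "b = 0"
    have "a \<bullet> x = b" if x: "x \<in> nabla G" for x
    proof -
      have "- x \<in> nabla G" using x by (force simp: nabla_def)
      with bound[OF x] bound[of "- x"] \<open>b = 0\<close> show ?thesis by auto
    qed
    with F_eq assms(2) show False by auto
  qed
  moreover have "\<exists>i j. x = axis i 1 - axis j 1" if "x \<in> nabla G" for x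
    using that by (force simp: nabla_def)
  ultimately show ?thesis
    unfolding roots_off_origin_def F_eq by blast
qed

theorem mainTheorem9:
  fixes G :: "'n::finite graph" and F :: "(real ^ 'n) set"
  assumes "verts G = UNIV"
    and "finite_simple_graph G"
    and "connected_graph G"
    and "edges G \<noteq> {}"
    and "face_of_points F (nabla G)"
    and "F \<noteq> {}"
    and "F \<noteq> nabla G"
  shows "(\<not> affine_dependent F \<longleftrightarrow> forest (face_graph F))
    \<and> (circuit F \<longleftrightarrow> is_chordless_cycle (face_graph F))
    \<and> dim_points F = int (card (verts (face_graph F)))
                     - int (card (components_of_graph (face_graph F))) - 1
    \<and> corank F = cyclomatic_number (face_graph F)"
proof -
  have F: "roots_off_origin F"
    using assms proper_face_roots_off_origin by blast
  have "dim_points F = int (dim F) - 1"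
    by (simp add: dim_points_def aff_dim_convex_hull aff_dim_roots_off_origin[OF F])
  then have dim: "dim_points F = int (card (verts (face_graph F)))
      - int (card (components_of_graph (face_graph F))) - 1"
    using card_quotient_add_dim[OF F] by linarith
  moreover have "edges (face_graph F) = face_edges F"
    by (simp add: face_graph_def edges_def)
  \<comment> \<open>With as many points as edges, the corank is |E| - (|V| - k - 1) - 1, where k
    counts the components.\<close>
  ultimately have "corank F = cyclomatic_number (face_graph F)"
    by (simp add: corank_def cyclomatic_number_def card_face_edges[OF F])
  with dim show ?thesis
    using affine_dependent_iff_dependent_off_origin[OF F] independent_iff_forest[OF F]
      circuit_imp_chordless_cycle[OF F] chordless_cycle_imp_circuit[OF F]
    by blast
qed

end
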